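(* Let $\mathcal C$ be the real vector space of elasticity tensors in three dimensions. For $C\in\mathcal C$ put $S^{ijkl}:=C^{(ijkl)}$ and $A^{ijkl}:=C^{ijkl}-C^{(ijkl)}$, and let $\mathcal S$ and $\mathcal A$ be the sets of all tensors $S$, respectively $A$, obtained in this way as $C$ ranges over $\mathcal C$. Then $\mathcal S$ and $\mathcal A$ are linear subspaces of $\mathcal C$ (so $S$ and $A$ again satisfy the minor and major symmetries), both are invariant under the action of $GL(3,\mathbb R)$, and $$\mathcal C=\mathcal S\oplus\mathcal A .$$ In particular, every $C\in\mathcal C$ is uniquely a sum of an element of $\mathcal S$ and an element of $\mathcal A$. Moreover the decomposition is irreducible: neither $\mathcal S$ nor $\mathcal A$ has a proper nonzero $GL(3,\mathbb R)$-invariant subspace.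
   Context: Indices run over $1,2,3$. An elasticity tensor is a real fourth-rank contravariant tensor $C^{ijkl}$ on $\mathbb R^3$ with the left and right minor symmetries $C^{ijkl}=C^{jikl}$, $C^{ijkl}=C^{ijlk}$ and the major symmetry $C^{ijkl}=C^{klij}$. Parentheses denote total symmetrization: $C^{(ijkl)}=\frac1{4!}\sum$ over all permutations of the four indices. The group $GL(3,\mathbb R)$ acts on fourth-rank tensors by $(L\cdot C)^{ijkl}=L^i{}_aL^j{}_bL^k{}_cL^l{}_d\,C^{abcd}$ (summation over repeated indices). *)

theory Defs
  imports "HOL-Analysis.Analysis"
begin

type_synonym tensor4 = "real^3^3^3^3"

definition elasticity_tensors :: "tensor4 set" where
  "elasticity_tensors =
     {C. (\<forall>i j k l. C $ i $ j $ k $ l = C $ j $ i $ k $ l) \<and>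
         (\<forall>i j k l. C $ i $ j $ k $ l = C $ i $ j $ l $ k) \<and>
         (\<forall>i j k l. C $ i $ j $ k $ l = C $ k $ l $ i $ j)}"

text \<open>The permutations act on the four index slots, not on the index values, so that repeated
  index values are counted with multiplicity: there are always 24 summands.\<close>

definition symmetrize :: "tensor4 \<Rightarrow> tensor4" where
  "symmetrize C =
     (\<chi> i j k l. (1 / fact 4) *
        (\<Sum>p | p permutes {..<4::nat}.
           (let I = [i, j, k, l] in C $ (I ! p 0) $ (I ! p 1) $ (I ! p 2) $ (I ! p 3))))"

definition symmetric_parts :: "tensor4 set" where
  "symmetric_parts = symmetrize ` elasticity_tensors"

definition asymmetric_parts :: "tensor4 set" where
  "asymmetric_parts = (\<lambda>C. C - symmetrize C) ` elasticity_tensors"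

definition tensor_action :: "real^3^3 \<Rightarrow> tensor4 \<Rightarrow> tensor4" where
  "tensor_action L C =
     (\<chi> i j k l. \<Sum>a\<in>UNIV. \<Sum>b\<in>UNIV. \<Sum>c\<in>UNIV. \<Sum>d\<in>UNIV.
        L $ i $ a * L $ j $ b * L $ k $ c * L $ l $ d * C $ a $ b $ c $ d)"

definition GL_invariant :: "tensor4 set \<Rightarrow> bool" where
  "GL_invariant W \<longleftrightarrow> (\<forall>L. invertible L \<longrightarrow> (\<forall>C\<in>W. tensor_action L C \<in> W))"

definition is_direct_sum :: "'a::real_vector set \<Rightarrow> 'a set \<Rightarrow> 'a set \<Rightarrow> bool" where
  "is_direct_sum V U W \<longleftrightarrow>
     subspace U \<and> subspace W \<and> V = {u + w | u w. u \<in> U \<and> w \<in> W} \<and> U \<inter> W = {0}"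

end

theory Submission
  imports Defs
begin

text \<open>Viewing tensors as quadrilinear forms, the two summands are cut out of the elasticity tensors
  by \<open>C\<^sup>i\<^sup>j\<^sup>k\<^sup>l = C\<^sup>i\<^sup>k\<^sup>j\<^sup>l\<close> and by the vanishing of the cyclic sum over \<open>j, k, l\<close>.

  Irreducibility: an invariant subspace \<open>W\<close> is closed, and invertible matrices are dense, so \<open>W\<close> is
  stable under all matrices, in particular singular ones. By polarization, an elasticity tensor
  with \<open>T(x,x,y,y) = 0\<close> for all \<open>x, y\<close> vanishes, and a totally symmetric one vanishes as soon as
  \<open>T(v,v,v,v) = 0\<close>. Given \<open>0 \<noteq> w \<in> W\<close>, a matrix of rank one (symmetric case) or at most two
  (asymmetric case) sends \<open>w\<close> to a nonzero multiple of a tensor whose inner product with \<open>T\<close> is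
  \<open>T(v,v,v,v)\<close>, respectively \<open>3 T(u,u,v,v)\<close>. Hence no nonzero \<open>T\<close> of the summand is orthogonal
  to \<open>W\<close>.\<close>

section \<open>Quadrilinear forms and the three-term formula for symmetrization\<close>

definition tensor_form :: "tensor4 \<Rightarrow> real^3 \<Rightarrow> real^3 \<Rightarrow> real^3 \<Rightarrow> real^3 \<Rightarrow> real" where
  "tensor_form T x y z w =
     (\<Sum>a\<in>UNIV. \<Sum>b\<in>UNIV. \<Sum>c\<in>UNIV. \<Sum>d\<in>UNIV. x $ a * y $ b * z $ c * w $ d * T $ a $ b $ c $ d)"

lemma elasticity_tensorsD:
  assumes "C \<in> elasticity_tensors"
  shows "C $ i $ j $ k $ l = C $ j $ i $ k $ l"
    and "C $ i $ j $ k $ l = C $ i $ j $ l $ k"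
    and "C $ i $ j $ k $ l = C $ k $ l $ i $ j"
  using assms unfolding elasticity_tensors_def by blast+

text \<open>The minor and major symmetries generate a group of order 8 on the index slots. The 24
  permutations therefore fall into three classes of 8, one for each way of splitting four slots into
  two pairs, and 8/24 = 1/3.\<close>

lemma symmetrize_elasticity_tensor:
  assumes "C \<in> elasticity_tensors"
  shows "symmetrize C $ i $ j $ k $ l =
           (C $ i $ j $ k $ l + C $ i $ k $ j $ l + C $ i $ l $ j $ k) / 3"
proof -
  have four: "{..<4::nat} = {0, 1, 2, 3}" by auto
  have orbit: "C $ b $ a $ c $ d = C $ a $ b $ c $ d" "C $ a $ b $ d $ c = C $ a $ b $ c $ d"
     "C $ b $ a $ d $ c = C $ a $ b $ c $ d" "C $ c $ d $ a $ b = C $ a $ b $ c $ d"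
     "C $ d $ c $ a $ b = C $ a $ b $ c $ d" "C $ c $ d $ b $ a = C $ a $ b $ c $ d"
     "C $ d $ c $ b $ a = C $ a $ b $ c $ d" for a b c d
    using elasticity_tensorsD[OF assms] by metis+
  have "symmetrize C $ i $ j $ k $ l = (1 / fact 4) *
      (8 * C $ i $ j $ k $ l + 8 * C $ i $ k $ j $ l + 8 * C $ i $ l $ j $ k)"
    unfolding symmetrize_def four
    \<comment> \<open>The first call enumerates the permutations. Instantiating \<open>orbit\<close>
      at fixed index names orients its equations towards one representative per class, so rewriting
      terminates.\<close>
    by (simp add: sum_over_permutations_insert permutes_empty Let_def transpose_def)
      (simp only: orbit[where a=i and b=j and c=k and d=l] orbit[where a=i and b=k and c=j and d=l]
        orbit[where a=i and b=l and c=j and d=k])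
  then show ?thesis by (simp add: fact_numeral)
qed

lemma tensor_form_add:
  "tensor_form T (x + x') y z w = tensor_form T x y z w + tensor_form T x' y z w"
  "tensor_form T x (y + y') z w = tensor_form T x y z w + tensor_form T x y' z w"
  "tensor_form T x y (z + z') w = tensor_form T x y z w + tensor_form T x y z' w"
  "tensor_form T x y z (w + w') = tensor_form T x y z w + tensor_form T x y z w'"
  by (simp_all add: tensor_form_def distrib_left distrib_right sum.distrib)

lemma tensor_form_scaleR:
  "tensor_form T (r *\<^sub>R x) y z w = r * tensor_form T x y z w"
  "tensor_form T x (r *\<^sub>R y) z w = r * tensor_form T x y z w"
  "tensor_form T x y (r *\<^sub>R z) w = r * tensor_form T x y z w"
  "tensor_form T x y z (r *\<^sub>R w) = r * tensor_form T x y z w"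
  by (simp_all add: tensor_form_def sum_distrib_left mult_ac)

lemma sum_axis_mult:
  fixes f :: "'n::finite \<Rightarrow> real"
  shows "(\<Sum>a\<in>UNIV. axis i 1 $ a * f a) = f i"
  using inner_vec_def[of "axis i 1" "\<chi> a. f a"] by (simp add: inner_axis')

lemma tensor_form_axis:
  "tensor_form T (axis i 1) (axis j 1) (axis k 1) (axis l 1) = T $ i $ j $ k $ l"
  by (simp add: tensor_form_def mult.assoc sum_axis_mult flip: sum_distrib_left)

text \<open>With the rows of \<open>L\<close> as arguments, an identity for the form under permuted
  arguments becomes an index symmetry of the transformed tensor, whether or not \<open>L\<close> is
  invertible.\<close>

lemma tensor_action_nth:
  "tensor_action L T $ i $ j $ k $ l = tensor_form T (L $ i) (L $ j) (L $ k) (L $ l)"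
  by (simp add: tensor_action_def tensor_form_def)

lemma sum4_swap:
  fixes f :: "'n::finite \<Rightarrow> 'n \<Rightarrow> 'n \<Rightarrow> 'n \<Rightarrow> real"
  shows "(\<Sum>a\<in>UNIV. \<Sum>b\<in>UNIV. \<Sum>c\<in>UNIV. \<Sum>d\<in>UNIV. f a b c d)
       = (\<Sum>a\<in>UNIV. \<Sum>b\<in>UNIV. \<Sum>c\<in>UNIV. \<Sum>d\<in>UNIV. f b a c d)"
    and "(\<Sum>a\<in>UNIV. \<Sum>b\<in>UNIV. \<Sum>c\<in>UNIV. \<Sum>d\<in>UNIV. f a b c d)
       = (\<Sum>a\<in>UNIV. \<Sum>b\<in>UNIV. \<Sum>c\<in>UNIV. \<Sum>d\<in>UNIV. f a c b d)"
    and "(\<Sum>a\<in>UNIV. \<Sum>b\<in>UNIV. \<Sum>c\<in>UNIV. \<Sum>d\<in>UNIV. f a b c d)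
       = (\<Sum>a\<in>UNIV. \<Sum>b\<in>UNIV. \<Sum>c\<in>UNIV. \<Sum>d\<in>UNIV. f a b d c)"
  by (rule sum.swap, rule sum.cong[OF refl], rule sum.swap,
      rule sum.cong[OF refl], rule sum.cong[OF refl], rule sum.swap)

text \<open>Moves a permutation from the arguments to the indices. Adjacent transpositions suffice,
  as they generate all slot permutations.\<close>

lemma tensor_form_swap:
  "tensor_form T y x z w = tensor_form (\<chi> i j k l. T $ j $ i $ k $ l) x y z w"
  "tensor_form T x z y w = tensor_form (\<chi> i j k l. T $ i $ k $ j $ l) x y z w"
  "tensor_form T x y w z = tensor_form (\<chi> i j k l. T $ i $ j $ l $ k) x y z w"
  unfolding tensor_form_def
  by (subst sum4_swap(1), simp add: mult_ac) (subst sum4_swap(2), simp add: mult_ac,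
      subst sum4_swap(3), simp add: mult_ac)

lemma tensor_form_plus:
  "tensor_form (S + T) x y z w = tensor_form S x y z w + tensor_form T x y z w"
  by (simp add: tensor_form_def distrib_left sum.distrib)

lemma tensor_form_symmetries:
  assumes "T \<in> elasticity_tensors"
  shows "tensor_form T x y z w = tensor_form T y x z w"
    and "tensor_form T x y z w = tensor_form T x y w z"
    and "tensor_form T x y z w = tensor_form T z w x y"
proof -
  note sym = elasticity_tensorsD[OF assms]
  have "(\<chi> i j k l. T $ j $ i $ k $ l) = T"
    by (simp add: vec_eq_iff sym(1))
  then show "tensor_form T x y z w = tensor_form T y x z w"
    by (simp add: tensor_form_swap(1)[of T y])
  have "(\<chi> i j k l. T $ i $ j $ l $ k) = T"
    by (simp add: vec_eq_iff sym(2))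
  then show "tensor_form T x y z w = tensor_form T x y w z"
    by (simp add: tensor_form_swap(3)[of T x y w])
  have "(\<chi> i j k l. T $ k $ l $ i $ j) = T"
    by (simp add: vec_eq_iff) (metis sym(3))
  then show "tensor_form T x y z w = tensor_form T z w x y"
    \<comment> \<open>The exchange of the two pairs is a product of four adjacent transpositions:
      zwxy, zxwy, xzwy, xzyw, xyzw.\<close>
    by (simp add: tensor_form_swap(2)[of T z w x y] tensor_form_swap(1)[of _ z x w y]
        tensor_form_swap(3)[of _ x z w y] tensor_form_swap(2)[of _ x z y w])
qed

section \<open>The two summands as solution sets of linear equations\<close>

lemma subspace_elasticity_tensors: "subspace elasticity_tensors"
  unfolding subspace_def elasticity_tensors_def by auto

lemma tensor_action_elasticity_tensors:
  assumes "T \<in> elasticity_tensors"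
  shows "tensor_action L T \<in> elasticity_tensors"
  unfolding elasticity_tensors_def mem_Collect_eq tensor_action_nth
  by (intro conjI allI; rule tensor_form_symmetries[OF assms])

text \<open>Together with the minor symmetries, exchanging the middle slots generates all
  permutations, so \<open>?S\<close> consists of the totally symmetric tensors. On these the three
  terms of the average coincide, and \<open>symmetrize\<close> is the identity.\<close>

lemma symmetric_parts_eq:
  "symmetric_parts =
     {C \<in> elasticity_tensors. \<forall>i j k l. C $ i $ j $ k $ l = C $ i $ k $ j $ l}" (is "_ = ?S")
proof
  show "symmetric_parts \<subseteq> ?S"
  proof
    fix S assume "S \<in> symmetric_parts"
    then obtain C where C: "C \<in> elasticity_tensors" and S: "S = symmetrize C"
      unfolding symmetric_parts_def by auto
    note sym = elasticity_tensorsD[OF C]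
    have sym12: "S $ i $ j $ k $ l = S $ j $ i $ k $ l" for i j k l
      unfolding S symmetrize_elasticity_tensor[OF C] using sym by (smt (verit))
    have sym34: "S $ i $ j $ k $ l = S $ i $ j $ l $ k" for i j k l
      unfolding S symmetrize_elasticity_tensor[OF C] using sym by (smt (verit))
    have sym23: "S $ i $ j $ k $ l = S $ i $ k $ j $ l" for i j k l
      unfolding S symmetrize_elasticity_tensor[OF C] using sym by (smt (verit))
    have major: "S $ i $ j $ k $ l = S $ k $ l $ i $ j" for i j k l
      using sym23[of i j k l] sym12[of i k j l] sym34[of k i j l] sym23[of k i l j] by simp
    show "S \<in> ?S"
      unfolding elasticity_tensors_def mem_Collect_eq
      by (intro conjI allI; (rule sym12 | rule sym34 | rule major | rule sym23))
  qed
  show "?S \<subseteq> symmetric_parts"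
  proof
    fix C assume C: "C \<in> ?S"
    then have "C $ i $ l $ j $ k = C $ i $ j $ k $ l" for i j k l
      using elasticity_tensorsD[of C] by (metis (mono_tags, lifting) mem_Collect_eq)
    with C have "symmetrize C = C"
      by (auto simp: vec_eq_iff symmetrize_elasticity_tensor)
    moreover have "C \<in> elasticity_tensors"
      using C by simp
    ultimately show "C \<in> symmetric_parts"
      unfolding symmetric_parts_def by (metis imageI)
  qed
qed

lemma symmetric_parts_subset: "symmetric_parts \<subseteq> elasticity_tensors"
  by (auto simp: symmetric_parts_eq)

text \<open>The three-term sum is three times the symmetrization, so \<open>?A\<close> is the kernel
  of \<open>symmetrize\<close> on elasticity tensors. As \<open>symmetrize\<close> is a projection
  there, the residuals \<open>C - symmetrize C\<close> fill exactly this kernel.\<close>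

lemma asymmetric_parts_eq:
  "asymmetric_parts =
     {C \<in> elasticity_tensors. \<forall>i j k l. C $ i $ j $ k $ l + C $ i $ k $ j $ l + C $ i $ l $ j $ k = 0}"
  (is "_ = ?A")
proof
  show "asymmetric_parts \<subseteq> ?A"
  proof
    fix A assume "A \<in> asymmetric_parts"
    then obtain C where C: "C \<in> elasticity_tensors" and A: "A = C - symmetrize C"
      unfolding asymmetric_parts_def by auto
    have "symmetrize C \<in> symmetric_parts"
      using C by (auto simp: symmetric_parts_def)
    then have "A \<in> elasticity_tensors"
      unfolding A using C symmetric_parts_subset subspace_diff subspace_elasticity_tensors by blast
    moreover have "A $ i $ j $ k $ l + A $ i $ k $ j $ l + A $ i $ l $ j $ k = 0" for i j k l
      using elasticity_tensorsD(2)[OF C]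
      by (simp add: A symmetrize_elasticity_tensor[OF C] field_simps)
    ultimately show "A \<in> ?A" by simp
  qed
  show "?A \<subseteq> asymmetric_parts"
  proof
    fix C assume C: "C \<in> ?A"
    then have "symmetrize C = 0"
      by (auto simp: vec_eq_iff symmetrize_elasticity_tensor)
    then have "C - symmetrize C = C"
      by simp
    moreover have "C \<in> elasticity_tensors"
      using C by simp
    ultimately show "C \<in> asymmetric_parts"
      unfolding asymmetric_parts_def by (metis (no_types, lifting) imageI)
  qed
qed

lemma subspace_symmetric_parts: "subspace symmetric_parts"
  unfolding subspace_def symmetric_parts_eq elasticity_tensors_def by auto

lemma subspace_asymmetric_parts: "subspace asymmetric_parts"
  unfolding subspace_def
proof (intro conjI ballI allI)
  show "0 \<in> asymmetric_parts"
    by (simp add: asymmetric_parts_eq elasticity_tensors_def)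
next
  fix A B assume "A \<in> asymmetric_parts" "B \<in> asymmetric_parts"
  then show "A + B \<in> asymmetric_parts"
    unfolding asymmetric_parts_eq elasticity_tensors_def by (simp, smt (verit))
next
  fix c A assume "A \<in> asymmetric_parts"
  then show "c *\<^sub>R A \<in> asymmetric_parts"
    unfolding asymmetric_parts_eq elasticity_tensors_def by (simp flip: distrib_left)
qed

section \<open>Invariance of the summands\<close>

lemma tensor_form_symmetric_parts:
  assumes "T \<in> symmetric_parts"
  shows "tensor_form T x y z w = tensor_form T x z y w"
proof -
  have "(\<chi> i j k l. T $ i $ k $ j $ l) = T"
    using assms by (simp add: symmetric_parts_eq vec_eq_iff)
  then show ?thesis
    by (simp add: tensor_form_swap(2)[of T x z])
qed

lemma tensor_form_asymmetric_parts:
  assumes "T \<in> asymmetric_parts"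
  shows "tensor_form T x y z w + tensor_form T x z y w + tensor_form T x w y z = 0"
proof -
  have "T + (\<chi> i j k l. T $ i $ k $ j $ l) + (\<chi> i j k l. T $ i $ l $ j $ k) = 0"
    using assms by (simp add: asymmetric_parts_eq vec_eq_iff)
  then have "tensor_form (T + (\<chi> i j k l. T $ i $ k $ j $ l) + (\<chi> i j k l. T $ i $ l $ j $ k)) x y z w = 0"
    by (simp add: tensor_form_def)
  then show ?thesis
    by (simp add: tensor_form_plus tensor_form_swap(2)[of T x z]
        tensor_form_swap(2)[of T x w y z] tensor_form_swap(3)[of _ x y w z])
qed

lemma GL_invariant_symmetric_parts: "GL_invariant symmetric_parts"
  using tensor_action_elasticity_tensors tensor_form_symmetric_parts symmetric_parts_subset
  \<comment> \<open>Only membership of the transformed tensor is unfolded; the hypothesis on the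
    original tensor stays in the shape that the lemmas on forms expect.\<close>
  unfolding GL_invariant_def symmetric_parts_eq[THEN eqset_imp_iff, of "tensor_action _ _"]
  by (auto simp: tensor_action_nth)

lemma GL_invariant_asymmetric_parts: "GL_invariant asymmetric_parts"
  using tensor_action_elasticity_tensors tensor_form_asymmetric_parts
  unfolding GL_invariant_def asymmetric_parts_eq[THEN eqset_imp_iff, of "tensor_action _ _"]
  by (auto simp: tensor_action_nth asymmetric_parts_eq)

section \<open>The direct sum\<close>

lemma parts_Int: "symmetric_parts \<inter> asymmetric_parts = {0}"
proof -
  have "C = 0" if "C \<in> symmetric_parts" "C \<in> asymmetric_parts" for C
  proof -
    have "C $ i $ j $ k $ l = 0" for i j k l
    proof -
      \<comment> \<open>Total symmetry makes the three terms of the vanishing cyclic sum equal, so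
        three times the component is zero.\<close>
      have "C $ i $ j $ k $ l = C $ i $ k $ j $ l" "C $ i $ l $ j $ k = C $ i $ j $ k $ l"
        using that elasticity_tensorsD[of C] unfolding symmetric_parts_eq
        by (metis (mono_tags, lifting) mem_Collect_eq)+
      with that show ?thesis
        unfolding asymmetric_parts_eq by (smt (verit) mem_Collect_eq)
    qed
    then show ?thesis by (simp add: vec_eq_iff)
  qed
  then show ?thesis
    using subspace_0[OF subspace_symmetric_parts] subspace_0[OF subspace_asymmetric_parts] by auto
qed

lemma is_direct_sum_parts: "is_direct_sum elasticity_tensors symmetric_parts asymmetric_parts"
proof -
  have "\<exists>S A. C = S + A \<and> S \<in> symmetric_parts \<and> A \<in> asymmetric_parts"
    if "C \<in> elasticity_tensors" for C
    using that unfolding symmetric_parts_def asymmetric_parts_def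
    by (intro exI[of _ "symmetrize C"] exI[of _ "C - symmetrize C"]) auto
  moreover have "S + A \<in> elasticity_tensors" if "S \<in> symmetric_parts" "A \<in> asymmetric_parts" for S A
    using that subspace_add[OF subspace_elasticity_tensors]
    by (simp add: symmetric_parts_eq asymmetric_parts_eq)
  ultimately show ?thesis
    unfolding is_direct_sum_def
    using parts_Int subspace_symmetric_parts subspace_asymmetric_parts by auto
qed

lemma is_direct_sum_imp_unique:
  assumes "is_direct_sum V U W" "v \<in> V"
  shows "\<exists>!p. p \<in> U \<times> W \<and> v = fst p + snd p"
proof -
  obtain u w where uw: "u \<in> U" "w \<in> W" "v = u + w"
    using assms unfolding is_direct_sum_def by auto
  have "u' = u \<and> w' = w" if "u' \<in> U" "w' \<in> W" "v = u' + w'" for u' w'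
  proof -
    have "u' - u = w - w'"
      using that uw by (simp add: algebra_simps)
    moreover have "u' - u \<in> U" "w - w' \<in> W"
      using that uw assms unfolding is_direct_sum_def by (auto intro: subspace_diff)
    ultimately have "u' - u \<in> U \<inter> W" by simp
    then have "u' - u = 0"
      using assms unfolding is_direct_sum_def by auto
    with \<open>u' - u = w - w'\<close> show ?thesis by simp
  qed
  note unique = this
  show ?thesis
  proof (rule ex1I[of _ "(u, w)"])
    show "(u, w) \<in> U \<times> W \<and> v = fst (u, w) + snd (u, w)"
      using uw by simp
    show "p = (u, w)" if "p \<in> U \<times> W \<and> v = fst p + snd p" for p
      using unique[of "fst p" "snd p"] that by (metis mem_Times_iff prod.collapse)
  qed
qed

section \<open>Vanishing criteria by polarization\<close>

lemma elasticity_tensor_eq_0I: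
  assumes T: "T \<in> elasticity_tensors" and zero: "\<And>x y. tensor_form T x x y y = 0"
  shows "T = 0"
proof -
  note sym = tensor_form_symmetries[OF T]
  \<comment> \<open>Expanding at \<open>x + z\<close> leaves two cross terms, equal by a minor
    symmetry. The next step does the same in the second pair.\<close>
  have 1: "tensor_form T x z y y = 0" for x y z
    using zero[of "x + z" y] by (simp add: tensor_form_add zero sym(1)[of z x])
  have "tensor_form T x z y w = 0" for x y z w
    using 1[of x z "y + w"] by (simp add: tensor_form_add 1 sym(2)[of x z w y])
  then show ?thesis
    by (simp add: vec_eq_iff flip: tensor_form_axis)
qed

lemma symmetric_part_eq_0I:
  assumes T: "T \<in> symmetric_parts" and zero: "\<And>v. tensor_form T v v v v = 0"
  shows "T = 0"
proof (rule elasticity_tensor_eq_0I)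
  show E: "T \<in> elasticity_tensors"
    using T symmetric_parts_subset by auto
  fix x y
  \<comment> \<open>In the sum over \<open>x + y\<close> and \<open>x - y\<close> the terms of odd
    degree in \<open>y\<close> cancel; the 6 mixed terms of degree two occur twice, whence
    12.\<close>
  have "tensor_form T (x + y) (x + y) (x + y) (x + y)
      + tensor_form T (x + (-1) *\<^sub>R y) (x + (-1) *\<^sub>R y) (x + (-1) *\<^sub>R y) (x + (-1) *\<^sub>R y)
      = 2 * tensor_form T x x x x + 12 * tensor_form T x x y y + 2 * tensor_form T y y y y"
    unfolding tensor_form_add tensor_form_scaleR
    by (simp add: tensor_form_symmetries(1,2)[OF E] tensor_form_symmetric_parts[OF T])
  then show "tensor_form T x x y y = 0"
    by (simp add: zero)
qed

section \<open>From invertible to arbitrary matrices\<close>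

lemma eventually_invertible_add_scaleR_mat:
  fixes L :: "real^3^3"
  shows "\<forall>\<^sub>F t in at 0. invertible (L + t *\<^sub>R mat 1)"
proof -
  \<comment> \<open>The coefficients of \<open>det (L + t *\<^sub>R mat 1)\<close> in
    \<open>t\<close>, constant term first: determinant, sum of the principal 2-minors, trace, 1. The
    leading 1 guarantees finitely many roots for every \<open>L\<close>.\<close>
  define p where "p = [:det L,
      L$1$1 * L$2$2 - L$1$2 * L$2$1 + L$1$1 * L$3$3 - L$1$3 * L$3$1 + L$2$2 * L$3$3 - L$2$3 * L$3$2,
      L$1$1 + L$2$2 + L$3$3, 1:]"
  have "det (L + t *\<^sub>R mat 1) = poly p t" for t
    by (simp add: p_def det_3 mat_def algebra_simps)
  moreover have "finite {t. poly p t = 0}"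
    by (rule poly_roots_finite) (simp add: p_def)
  then have "\<forall>\<^sub>F t in at 0. poly p t \<noteq> 0"
    using islimpt_finite[of "{t. poly p t = 0}" 0] by (simp add: islimpt_conv_frequently_at frequently_def)
  ultimately show ?thesis
    by (simp add: invertible_det_nz)
qed

lemma GL_invariant_imp_tensor_action:
  assumes W: "subspace W" "GL_invariant W" and "T \<in> W"
  shows "tensor_action L T \<in> W"
proof (rule Lim_in_closed_set)
  show "closed W"
    using W(1) by (rule closed_subspace)
  show "\<forall>\<^sub>F t in at 0. tensor_action (L + t *\<^sub>R mat 1) T \<in> W"
    using eventually_invertible_add_scaleR_mat[of L]
    by eventually_elim (use assms in \<open>auto simp: GL_invariant_def\<close>)
  have "((\<lambda>t. tensor_action (L + t *\<^sub>R mat 1) T) \<longlongrightarrow> tensor_action (L + 0 *\<^sub>R mat 1) T) (at 0)"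
    unfolding tensor_action_def by (intro tendsto_intros)
  then show "((\<lambda>t. tensor_action (L + t *\<^sub>R mat 1) T) \<longlongrightarrow> tensor_action L T) (at 0)"
    by simp
qed simp

section \<open>Irreducibility by orthogonality\<close>

definition tensor_product :: "real^3 \<Rightarrow> real^3 \<Rightarrow> real^3 \<Rightarrow> real^3 \<Rightarrow> tensor4" where
  "tensor_product x y z w = (\<chi> i j k l. x $ i * y $ j * z $ k * w $ l)"

text \<open>Turns orthogonality to simple tensors in \<open>W\<close> into vanishing values of the
  form.\<close>

lemma inner_tensor_product: "T \<bullet> tensor_product x y z w = tensor_form T x y z w"
  by (simp add: inner_vec_def tensor_product_def tensor_form_def sum_distrib_left mult_ac)

text \<open>A proper subspace of \<open>V\<close> would leave a nonzero vector of \<open>V\<close>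
  orthogonal to it.\<close>

lemma subspace_eq_if_orthogonal_trivial:
  fixes V W :: "'a::euclidean_space set"
  assumes "subspace V" "subspace W" "W \<subseteq> V"
    and trivial: "\<And>T. T \<in> V \<Longrightarrow> (\<And>w. w \<in> W \<Longrightarrow> T \<bullet> w = 0) \<Longrightarrow> T = 0"
  shows "W = V"
proof (rule ccontr)
  assume "W \<noteq> V"
  then have "span W \<subset> span V"
    using assms(1-3) span_eq_iff by blast
  then obtain T where "T \<noteq> 0" "T \<in> span V" "\<And>w. w \<in> span W \<Longrightarrow> orthogonal T w"
    using orthogonal_to_subspace_exists_gen by metis
  then show False
    using trivial[of T] assms(1,2) span_eq_iff by (metis orthogonal_def)
qed

lemma symmetric_parts_irreducible:
  assumes W: "subspace W" "W \<subseteq> symmetric_parts" "GL_invariant W" and "W \<noteq> {0}"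
  shows "W = symmetric_parts"
proof (rule subspace_eq_if_orthogonal_trivial[OF subspace_symmetric_parts W(1,2)])
  obtain w where w: "w \<in> W" "w \<noteq> 0"
    using \<open>W \<noteq> {0}\<close> subspace_0[OF W(1)] by blast
  then obtain \<xi> where \<xi>: "tensor_form w \<xi> \<xi> \<xi> \<xi> \<noteq> 0"
    using symmetric_part_eq_0I W(2) by blast
  fix T assume T: "T \<in> symmetric_parts" and orth: "\<And>w. w \<in> W \<Longrightarrow> T \<bullet> w = 0"
  show "T = 0"
  proof (rule symmetric_part_eq_0I[OF T])
    fix v
    \<comment> \<open>Every row of this matrix is a multiple of \<xi>, so all components of the
      image share one value of the form as a factor.\<close>
    have "tensor_action (\<chi> i. v $ i *\<^sub>R \<xi>) w = tensor_form w \<xi> \<xi> \<xi> \<xi> *\<^sub>R tensor_product v v v v"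
      by (simp add: vec_eq_iff tensor_action_nth tensor_form_scaleR tensor_product_def)
    then show "tensor_form T v v v v = 0"
      using orth[OF GL_invariant_imp_tensor_action[OF W(1,3) w(1), of "\<chi> i. v $ i *\<^sub>R \<xi>"]] \<xi>
      by (simp add: inner_tensor_product)
  qed
qed

text \<open>On two vectors the form is governed by the single number
  \<open>tensor_form T x x y y\<close>. The cyclic identity at x,x,x,y gives three equal terms with
  sum zero; at x,x,y,y it says that twice the interleaved value cancels the paired one.\<close>

lemma tensor_form_asymmetric_parts_repeated:
  assumes T: "T \<in> asymmetric_parts"
  shows "tensor_form T x x x y = 0" "tensor_form T x x y x = 0"
    "tensor_form T x y x x = 0" "tensor_form T y x x x = 0"
    "tensor_form T y y x x = tensor_form T x x y y"
    "tensor_form T x y x y = - tensor_form T x x y y / 2"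
    "tensor_form T x y y x = - tensor_form T x x y y / 2"
proof -
  have E: "T \<in> elasticity_tensors"
    using T by (simp add: asymmetric_parts_eq)
  note sym = tensor_form_symmetries[OF E]
  show 1: "tensor_form T x x x y = 0"
    using tensor_form_asymmetric_parts[OF T, of x x x y] sym(2)[of x y x x] sym(3)[of x y x x] by simp
  then show 2: "tensor_form T x x y x = 0"
    using sym(2) by metis
  show "tensor_form T x y x x = 0" "tensor_form T y x x x = 0"
    using 1 2 sym(3) by metis+
  show "tensor_form T y y x x = tensor_form T x x y y"
    by (rule sym(3))
  show 3: "tensor_form T x y x y = - tensor_form T x x y y / 2"
    using tensor_form_asymmetric_parts[OF T, of x x y y] by simp
  then show "tensor_form T x y y x = - tensor_form T x x y y / 2"
    using sym(2) by metis
qed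

lemma asymmetric_parts_irreducible:
  assumes W: "subspace W" "W \<subseteq> asymmetric_parts" "GL_invariant W" and "W \<noteq> {0}"
  shows "W = asymmetric_parts"
proof (rule subspace_eq_if_orthogonal_trivial[OF subspace_asymmetric_parts W(1,2)])
  obtain w where w: "w \<in> W" "w \<noteq> 0"
    using \<open>W \<noteq> {0}\<close> subspace_0[OF W(1)] by blast
  then have wA: "w \<in> asymmetric_parts" using W(2) by auto
  then have "w \<in> elasticity_tensors" by (simp add: asymmetric_parts_eq)
  then obtain \<xi> \<eta> where nz: "tensor_form w \<xi> \<xi> \<eta> \<eta> \<noteq> 0"
    using elasticity_tensor_eq_0I w by blast
  fix T assume T: "T \<in> asymmetric_parts" and orth: "\<And>w. w \<in> W \<Longrightarrow> T \<bullet> w = 0"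
  show "T = 0"
  proof (rule elasticity_tensor_eq_0I)
    show "T \<in> elasticity_tensors" using T by (simp add: asymmetric_parts_eq)
    fix u v
    define L :: "real^3^3" where "L = (\<chi> i. u $ i *\<^sub>R \<xi> + v $ i *\<^sub>R \<eta>)"
    \<comment> \<open>Expanding the form of \<open>w\<close> on rows of \<open>L\<close> gives 16
      terms. The 10 with three or four equal arguments vanish; the two paired ones have weight 1 and
      the four interleaved ones weight -1/2.\<close>
    let ?B = "tensor_product u u v v + tensor_product v v u u
      - (1/2) *\<^sub>R (tensor_product u v u v + tensor_product u v v u
                  + tensor_product v u u v + tensor_product v u v u)"
    have w0: "tensor_form w \<xi> \<xi> \<xi> \<xi> = 0" "tensor_form w \<eta> \<eta> \<eta> \<eta> = 0"
      by (rule tensor_form_asymmetric_parts_repeated[OF wA])+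
    \<comment> \<open>The fifth fact is taken in one orientation only, since both together would
      make rewriting loop.\<close>
    note rep = w0 tensor_form_asymmetric_parts_repeated[OF wA, of \<xi> \<eta>]
      tensor_form_asymmetric_parts_repeated(1-4,6,7)[OF wA, of \<eta> \<xi>]
    have "tensor_action L w = tensor_form w \<xi> \<xi> \<eta> \<eta> *\<^sub>R ?B"
      by (simp add: vec_eq_iff tensor_action_nth tensor_form_add tensor_form_scaleR
          tensor_product_def L_def rep) (simp add: field_simps)
    then have "T \<bullet> ?B = 0"
      using orth[OF GL_invariant_imp_tensor_action[OF W(1,3) w(1), of L]] nz by simp
    \<comment> \<open>The same relations for \<open>T\<close> evaluate the inner product: the paired
      terms contribute 1 + 1, the interleaved ones 4 * (-1/2) * (-1/2) = 1.\<close>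
    then have "3 * tensor_form T u u v v = 0"
      using tensor_form_asymmetric_parts_repeated[OF T, of u v]
        tensor_form_asymmetric_parts_repeated(6,7)[OF T, of v u]
      by (simp add: inner_diff_right inner_add_right inner_tensor_product)
    then show "tensor_form T u u v v = 0" by simp
  qed
qed

theorem mainTheorem1:
  shows "subspace elasticity_tensors
    \<and> subspace symmetric_parts \<and> symmetric_parts \<subseteq> elasticity_tensors
    \<and> subspace asymmetric_parts \<and> asymmetric_parts \<subseteq> elasticity_tensors
    \<and> GL_invariant symmetric_parts \<and> GL_invariant asymmetric_parts
    \<and> is_direct_sum elasticity_tensors symmetric_parts asymmetric_parts
    \<and> (\<forall>C\<in>elasticity_tensors. \<exists>!p. p \<in> symmetric_parts \<times> asymmetric_parts \<and> C = fst p + snd p)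
    \<and> (\<forall>W. subspace W \<and> W \<subseteq> symmetric_parts \<and> GL_invariant W
           \<longrightarrow> W = {0} \<or> W = symmetric_parts)
    \<and> (\<forall>W. subspace W \<and> W \<subseteq> asymmetric_parts \<and> GL_invariant W
           \<longrightarrow> W = {0} \<or> W = asymmetric_parts)"
proof (intro conjI ballI)
  show "asymmetric_parts \<subseteq> elasticity_tensors"
    by (auto simp: asymmetric_parts_eq)
  show "\<exists>!p. p \<in> symmetric_parts \<times> asymmetric_parts \<and> C = fst p + snd p"
    if "C \<in> elasticity_tensors" for C
    using is_direct_sum_parts that by (rule is_direct_sum_imp_unique)
  show "\<forall>W. subspace W \<and> W \<subseteq> symmetric_parts \<and> GL_invariant W
      \<longrightarrow> W = {0} \<or> W = symmetric_parts"
    using symmetric_parts_irreducible by auto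
  show "\<forall>W. subspace W \<and> W \<subseteq> asymmetric_parts \<and> GL_invariant W
      \<longrightarrow> W = {0} \<or> W = asymmetric_parts"
    using asymmetric_parts_irreducible by auto
qed (fact subspace_elasticity_tensors subspace_symmetric_parts symmetric_parts_subset
    subspace_asymmetric_parts GL_invariant_symmetric_parts GL_invariant_asymmetric_parts
    is_direct_sum_parts)+

end
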